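(* Let $\|\cdot\|$ be a norm on $\mathbb{R}^d$, with dual norm $\|\cdot\|_\star$. The following assertions are equivalent. 1. The norm $\|\cdot\|$ is orthant-strictly monotonic. 2. For all $K\subset\{1,\dots,d\}$, $\mathcal{R}_K$ is strictly Birkhoff orthogonal to $\mathcal{R}_{-K}$, that is, $\|u+v\|>\|u\|$ for all $u\in\mathcal{R}_K$ and all $v\in\mathcal{R}_{-K}\setminus\{0\}$. 3. For any $x\in\mathbb{R}^d$ and any $J\subsetneq K\subset\{1,\dots,d\}$, if $x_J\ne x_K$ then $\|x_J\|<\|x_K\|$. 4. For any vector $u\in\mathbb{R}^d\setminus\{0\}$, there exists a vector $v\in\mathbb{R}^d\setminus\{0\}$ such that $\mathrm{supp}(v)=\mathrm{supp}(u)$, $u\circ v\ge 0$, and $\langle u,v\rangle=\|u\|\,\|v\|_\star$.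
   Context: $d\ge 1$ is an integer and $\mathbb{R}^d$ carries the standard scalar product $\langle\cdot,\cdot\rangle$. The dual norm is $\|y\|_\star=\sup_{\|x\|\le 1}\langle x,y\rangle$. For $x\in\mathbb{R}^d$, $\mathrm{supp}(x)=\{j : x_j\ne 0\}$, $|x|=(|x_1|,\dots,|x_d|)$, and $x\circ x'=(x_1x_1',\dots,x_dx_d')$ is the entrywise product; $x\circ x'\ge0$ is componentwise. $|x|<|x'|$ means that $|x_i|\le|x_i'|$ for all $i$ and that there exists $j$ with $|x_j|<|x_j'|$. For $K\subset\{1,\dots,d\}$, $-K=\{1,\dots,d\}\setminus K$, $\mathcal{R}_K=\{x\in\mathbb{R}^d : x_j=0 \ \forall j\notin K\}$ (with $\mathcal{R}_\emptyset=\{0\}$), and $x_K\in\mathcal{R}_K$ is the vector that coincides with $x$ on $K$ and is zero outside $K$. A norm $\|\cdot\|$ is orthant-strictly monotonic if, for all $x,x'\in\mathbb{R}^d$, ($|x|<|x'|$ and $x\circ x'\ge 0$) implies $\|x\|<\|x'\|$. *)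

theory Defs
  imports "HOL-Analysis.Analysis"
begin

(* R^d is real^'d with 'd an arbitrary finite index type (nonempty, so d >= 1).
   On this type the library operations *, abs, <= act entrywise, so u * v is the
   entrywise product and |x| the entrywise absolute value; the class constant norm is
   the Euclidean norm, whence arbitrary norms are modelled as functions N. *)

definition is_norm :: "(real^'d \<Rightarrow> real) \<Rightarrow> bool" where
  "is_norm N \<longleftrightarrow>
     (\<forall>x. 0 \<le> N x) \<and> (\<forall>x. N x = 0 \<longleftrightarrow> x = 0) \<and>
     (\<forall>a x. N (a *\<^sub>R x) = \<bar>a\<bar> * N x) \<and>
     (\<forall>x y. N (x + y) \<le> N x + N y)"

(* When N is a norm, the set below is nonempty and bounded above (all norms on R^d are
   equivalent), so the conditional supremum on the reals is the true supremum. *)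
definition dual_norm :: "(real^'d \<Rightarrow> real) \<Rightarrow> real^'d \<Rightarrow> real" where
  "dual_norm N y = (SUP x\<in>{x. N x \<le> 1}. x \<bullet> y)"

definition supp :: "real^'d \<Rightarrow> 'd set" where
  "supp x = {j. x $ j \<noteq> 0}"

definition coord_subspace :: "'d set \<Rightarrow> (real^'d) set" where
  "coord_subspace K = {x. \<forall>j. j \<notin> K \<longrightarrow> x $ j = 0}"

definition coord_restrict :: "real^'d \<Rightarrow> 'd set \<Rightarrow> real^'d" where
  "coord_restrict x K = (\<chi> j. if j \<in> K then x $ j else 0)"

(* The library's strict order on real^'d requires only one strict entry. *)
lemma abs_vec_less_iff:
  fixes x y :: "real^'d"
  shows "\<bar>x\<bar> < \<bar>y\<bar> \<longleftrightarrow> (\<forall>i. \<bar>x $ i\<bar> \<le> \<bar>y $ i\<bar>) \<and> (\<exists>j. \<bar>x $ j\<bar> < \<bar>y $ j\<bar>)"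
  by (auto simp: less_vec_def less_eq_vec_def abs_vec_def not_le)

definition orthant_strictly_monotonic :: "(real^'d \<Rightarrow> real) \<Rightarrow> bool" where
  "orthant_strictly_monotonic N \<longleftrightarrow>
     (\<forall>x x'. \<bar>x\<bar> < \<bar>x'\<bar> \<and> x * x' \<ge> 0 \<longrightarrow> N x < N x')"

definition strictly_Birkhoff_orthogonal ::
    "(real^'d \<Rightarrow> real) \<Rightarrow> (real^'d) set \<Rightarrow> (real^'d) set \<Rightarrow> bool" where
  "strictly_Birkhoff_orthogonal N U V \<longleftrightarrow> (\<forall>u\<in>U. \<forall>v\<in>V - {0}. N (u + v) > N u)"

end

theory Submission
  imports Defs
begin

text \<open>
  Assertions 2 and 3 say the same thing: a pair \<open>(x\<^sub>J, x\<^sub>K)\<close> with \<open>J \<subset> K\<close> is a pair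
  \<open>(u, u + v)\<close> with \<open>u\<close> and \<open>v\<close> in complementary coordinate subspaces. Both are the
  special case of orthant-strict monotonicity in which entries are set to zero. Convexity
  gives the general case back: along the ray \<open>t \<mapsto> u + t v\<close> a norm is convex, so once its
  value at \<open>t = 1\<close> exceeds the one at \<open>t = 0\<close>, it exceeds all those with \<open>0 \<le> t < 1\<close>
  (\<open>norm_ray_less\<close>). Changing one entry at a time then reaches every pair
  \<open>|x| < |x'|\<close> in a common orthant.

  For assertion 4, a dual vector of \<open>u\<close> is a subgradient of the norm at \<open>u\<close>, which exists by
  separation of \<open>u\<close> from the open ball of radius \<open>N u\<close> (\<open>ex_subgradient\<close>). If the norm
  decreases strictly whenever entries are zeroed, restricting a subgradient to the support of
  \<open>u\<close> leaves it a subgradient, and deleting the entry \<open>u\<^sub>j \<noteq> 0\<close> shows \<open>u\<^sub>j v\<^sub>j > 0\<close>. Hence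
  support and signs come out as required. Conversely, let \<open>u\<close> and \<open>w \<noteq> 0\<close> lie in
  complementary coordinate subspaces. A dual vector of \<open>u\<close> vanishes on \<open>w\<close>, which gives only
  the weak inequality \<open>N u \<le> N (u + w)\<close>. Strictness comes from a dual vector of the midpoint
  \<open>u + w/2\<close>: it pairs strictly positively with \<open>w\<close>, so
  \<open>N u \<le> N (u + w/2) < N (u + w)\<close>.
\<close>

section \<open>Norms and their dual norms\<close>

lemma
  assumes "is_norm N"
  shows is_norm_zero: "N 0 = 0"
    and is_norm_pos: "x \<noteq> 0 \<Longrightarrow> 0 < N x"
    and is_norm_scaleR: "N (a *\<^sub>R x) = \<bar>a\<bar> * N x"
    and is_norm_triangle: "N (x + y) \<le> N x + N y"
  using assms unfolding is_norm_def by (auto simp: order.strict_iff_order)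

lemma is_norm_convex_on:
  assumes "is_norm N"
  shows "convex_on UNIV N"
proof (rule convex_onI)
  fix t x y assume "0 < t" "t < (1::real)"
  then show "N ((1 - t) *\<^sub>R x + t *\<^sub>R y) \<le> (1 - t) * N x + t * N y"
    using is_norm_triangle[OF assms, of "(1 - t) *\<^sub>R x" "t *\<^sub>R y"]
    by (simp add: is_norm_scaleR[OF assms])
qed simp

text \<open>Equivalence with the Euclidean norm: a convex function is continuous, so \<open>N\<close> attains a
  minimum on the unit sphere, and that minimum is positive.\<close>

lemma is_norm_bounds_euclidean:
  fixes N :: "real^'d \<Rightarrow> real"
  assumes "is_norm N"
  obtains c where "0 < c" "\<And>x. c * norm x \<le> N x"
proof -
  have "continuous_on UNIV N"
    using is_norm_convex_on[OF assms] by (intro convex_on_continuous) auto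
  then have "continuous_on (sphere 0 1) N"
    by (rule continuous_on_subset) simp
  moreover have "sphere (0 :: real^'d) 1 \<noteq> {}"
    by simp
  ultimately obtain m where m: "m \<in> sphere 0 1" "\<And>y. y \<in> sphere 0 1 \<Longrightarrow> N m \<le> N y"
    using continuous_attains_inf[of "sphere 0 1" N] compact_sphere by blast
  have "N m * norm x \<le> N x" for x
  proof (cases "x = 0")
    case False
    then have "N m \<le> N ((1 / norm x) *\<^sub>R x)"
      by (intro m(2)) simp
    with False show ?thesis
      by (simp add: is_norm_scaleR[OF assms] field_simps)
  qed (simp add: is_norm_zero[OF assms])
  moreover have "0 < N m"
    using m(1) by (intro is_norm_pos[OF assms]) auto
  ultimately show ?thesis
    using that by blast
qed

lemma dual_norm_bdd_above:
  fixes N :: "real^'d \<Rightarrow> real"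
  assumes "is_norm N"
  shows "bdd_above ((\<lambda>x. x \<bullet> y) ` {x. N x \<le> 1})"
proof -
  obtain c where c: "0 < c" "\<And>x. c * norm x \<le> N x"
    using is_norm_bounds_euclidean[OF assms] by blast
  have "x \<bullet> y \<le> 1 / c * norm y" if "N x \<le> 1" for x
  proof -
    have "norm x \<le> 1 / c"
      using c(1) c(2)[of x] that by (simp add: field_simps)
    then have "norm x * norm y \<le> 1 / c * norm y"
      by (rule mult_right_mono) simp
    then show ?thesis
      using norm_cauchy_schwarz[of x y] by linarith
  qed
  then show ?thesis
    by (auto intro!: bdd_aboveI2)
qed

lemma inner_le_dual_norm:
  fixes N :: "real^'d \<Rightarrow> real"
  assumes "is_norm N"
  shows "x \<bullet> y \<le> N x * dual_norm N y"
proof (cases "x = 0")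
  case False
  then have pos: "0 < N x"
    by (rule is_norm_pos[OF assms])
  then have "((1 / N x) *\<^sub>R x) \<bullet> y \<le> dual_norm N y"
    unfolding dual_norm_def
    by (intro cSUP_upper dual_norm_bdd_above[OF assms]) (simp add: is_norm_scaleR[OF assms])
  with pos show ?thesis
    by (simp add: field_simps)
qed (simp add: is_norm_zero[OF assms])

lemma dual_norm_pos:
  fixes N :: "real^'d \<Rightarrow> real"
  assumes "is_norm N" "y \<noteq> 0"
  shows "0 < dual_norm N y"
proof -
  have "0 < N y * dual_norm N y"
    using inner_le_dual_norm[OF assms(1), of y y] assms(2)
    by (metis inner_gt_zero_iff order.strict_trans2)
  then show ?thesis
    using is_norm_pos[OF assms] by (simp add: zero_less_mult_iff)
qed

lemma dual_norm_eq_1: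
  fixes N :: "real^'d \<Rightarrow> real"
  assumes "is_norm N" "u \<noteq> 0" "u \<bullet> v = N u" "\<And>x. x \<bullet> v \<le> N x"
  shows "dual_norm N v = 1"
proof (rule antisym)
  have "N 0 \<le> 1"
    by (simp add: is_norm_zero[OF assms(1)])
  then show "dual_norm N v \<le> 1"
    unfolding dual_norm_def using assms(4) by (intro cSUP_least) (auto intro: order_trans)
  show "1 \<le> dual_norm N v"
    using inner_le_dual_norm[OF assms(1), of u v] is_norm_pos[OF assms(1,2)] assms(3) by simp
qed

text \<open>Hahn--Banach for a norm: a hyperplane through \<open>u\<close> that misses the open ball of radius
  \<open>N u\<close>, with its normal vector scaled to pair with \<open>u\<close> to \<open>N u\<close>.\<close>

lemma ex_subgradient:
  fixes N :: "real^'d \<Rightarrow> real"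
  assumes nN: "is_norm N" and u: "u \<noteq> 0"
  obtains v where "u \<bullet> v = N u" "\<And>x. x \<bullet> v \<le> N x"
proof -
  note pos = is_norm_pos[OF nN] and scale = is_norm_scaleR[OF nN]
  have "N (s *\<^sub>R x + t *\<^sub>R y) < N u"
    if "N x < N u" "N y < N u" "0 \<le> s" "0 \<le> t" "s + t = 1" for x y s t
  proof -
    have "N (s *\<^sub>R x + t *\<^sub>R y) \<le> s * N x + t * N y"
      using is_norm_triangle[OF nN, of "s *\<^sub>R x" "t *\<^sub>R y"] that(3,4) by (simp add: scale)
    also have "\<dots> < N u"
      using that by (intro convex_bound_lt)
    finally show ?thesis .
  qed
  then have "convex {x. N x < N u}"
    by (auto intro: convexI)
  moreover have "0 \<in> {x. N x < N u}"
    using pos[OF u] by (simp add: is_norm_zero[OF nN])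
  ultimately obtain a b where a: "a \<noteq> 0" "\<And>x. N x < N u \<Longrightarrow> a \<bullet> x \<le> b" "b \<le> a \<bullet> u"
    using separating_hyperplane_sets[of "{x. N x < N u}" "{u}"] by auto
  have ball: "a \<bullet> x \<le> a \<bullet> u" if "N x < N u" for x
    using a(2)[OF that] a(3) by simp
  have scaled: "N u * (a \<bullet> x) \<le> N x * (a \<bullet> u)" for x
  proof (cases "x = 0")
    case False
    have "t * (N u / N x * (a \<bullet> x)) \<le> a \<bullet> u" if "0 < t" "t < 1" for t
      using ball[of "(t * (N u / N x)) *\<^sub>R x"] that pos[OF u] pos[OF False]
      by (simp add: scale mult.assoc)
    then have "N u / N x * (a \<bullet> x) \<le> a \<bullet> u"
      by (rule field_le_mult_one_interval)
    with pos[OF False] show ?thesis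
      by (simp add: field_simps)
  qed (simp add: is_norm_zero[OF nN])
  have "0 < N u * (a \<bullet> a)"
    using pos[OF u] a(1) by simp
  with scaled[of a] have "0 < N a * (a \<bullet> u)"
    by linarith
  then have au: "0 < a \<bullet> u"
    using pos[OF a(1)] by (simp add: zero_less_mult_iff)
  show ?thesis
  proof (rule that)
    show "u \<bullet> ((N u / (a \<bullet> u)) *\<^sub>R a) = N u"
      using au by (simp add: inner_commute)
    show "x \<bullet> ((N u / (a \<bullet> u)) *\<^sub>R a) \<le> N x" for x
      using scaled[of x] au by (simp add: inner_commute field_simps)
  qed
qed

section \<open>Orthant-strict monotonicity and Birkhoff orthogonality\<close>

text \<open>\<open>u + s v\<close> is a convex combination of \<open>u\<close> and \<open>u + v\<close> in which \<open>u\<close>, the point of smaller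
  norm, has positive weight.\<close>

lemma norm_ray_less:
  fixes N :: "real^'d \<Rightarrow> real"
  assumes "is_norm N" "N u < N (u + v)" "0 \<le> s" "s < 1"
  shows "N (u + s *\<^sub>R v) < N (u + v)"
proof -
  have "u + s *\<^sub>R v = (1 - s) *\<^sub>R u + s *\<^sub>R (u + v)"
    by (simp add: algebra_simps)
  then have "N (u + s *\<^sub>R v) \<le> (1 - s) * N u + s * N (u + v)"
    using is_norm_triangle[OF assms(1), of "(1 - s) *\<^sub>R u" "s *\<^sub>R (u + v)"] assms(3,4)
    by (simp add: is_norm_scaleR[OF assms(1)])
  moreover have "(1 - s) * N u < (1 - s) * N (u + v)"
    using assms(2,4) by simp
  ultimately show ?thesis
    by (simp add: algebra_simps)
qed

abbreviation (input) complementary_orthogonal :: "(real^'d \<Rightarrow> real) \<Rightarrow> bool" where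
  "complementary_orthogonal N \<equiv>
     \<forall>K. strictly_Birkhoff_orthogonal N (coord_subspace K) (coord_subspace (- K))"

lemma complementary_orthogonalD:
  assumes "complementary_orthogonal N" "u \<in> coord_subspace K" "v \<in> coord_subspace (- K)" "v \<noteq> 0"
  shows "N u < N (u + v)"
  using assms unfolding strictly_Birkhoff_orthogonal_def by blast

lemma norm_grow_entry_less:
  fixes N :: "real^'d \<Rightarrow> real"
  assumes nN: "is_norm N" and orth: "complementary_orthogonal N"
    and "u $ j = 0" "\<bar>a\<bar> \<le> \<bar>b\<bar>" "0 \<le> a * b" "a \<noteq> b"
  shows "N (u + axis j a) < N (u + axis j b)"
proof -
  have b: "b \<noteq> 0"
    using assms(4,6) by auto
  have "u \<in> coord_subspace (- {j})" "axis j b \<in> coord_subspace (- (- {j}))" "axis j b \<noteq> 0"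
    using b \<open>u $ j = 0\<close> by (auto simp: coord_subspace_def axis_def vec_eq_iff)
  then have "N u < N (u + axis j b)"
    by (rule complementary_orthogonalD[OF orth])
  moreover have "0 \<le> a / b" "a / b < 1"
    using assms(4-6) b by (auto simp: divide_simps zero_le_mult_iff)
  ultimately have "N (u + (a / b) *\<^sub>R axis j b) < N (u + axis j b)"
    by (rule norm_ray_less[OF nN])
  moreover have "(a / b) *\<^sub>R axis j b = axis j a"
    using b by (simp add: vec_eq_iff axis_def)
  ultimately show ?thesis
    by simp
qed

text \<open>The hypotheses describe \<open>|x| < |x'|\<close> within one orthant; the form \<open>x \<noteq> x'\<close> of strictness
  lets the induction run on the number of entries in which \<open>x\<close> and \<open>x'\<close> differ.\<close>

lemma norm_grow_entries_less:
  fixes N :: "real^'d \<Rightarrow> real"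
  assumes nN: "is_norm N" and orth: "complementary_orthogonal N"
    and "\<And>i. \<bar>x $ i\<bar> \<le> \<bar>x' $ i\<bar>" "\<And>i. 0 \<le> x $ i * x' $ i" "x \<noteq> x'"
  shows "N x < N x'"
  using assms(3-5)
proof (induction "card {i. x $ i \<noteq> x' $ i}" arbitrary: x rule: less_induct)
  case less
  then obtain j where j: "x $ j \<noteq> x' $ j"
    by (auto simp: vec_eq_iff)
  define u where "u = (\<chi> i. if i = j then 0 else x $ i)"
  define y where "y = u + axis j (x' $ j)"
  have "x = u + axis j (x $ j)"
    by (auto simp: u_def axis_def vec_eq_iff)
  moreover have "N (u + axis j (x $ j)) < N y"
    unfolding y_def using less.prems(1,2) j
    by (intro norm_grow_entry_less[OF nN orth]) (auto simp: u_def)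
  ultimately have xy: "N x < N y"
    by simp
  have y: "y $ i = (if i = j then x' $ i else x $ i)" for i
    by (auto simp: y_def u_def axis_def)
  show ?case
  proof (cases "y = x'")
    case False
    have "{i. y $ i \<noteq> x' $ i} \<subset> {i. x $ i \<noteq> x' $ i}"
      using j by (auto simp: y)
    then have "card {i. y $ i \<noteq> x' $ i} < card {i. x $ i \<noteq> x' $ i}"
      by (intro psubset_card_mono) auto
    then have "N y < N x'"
      using less.prems(1,2) False by (intro less.hyps) (auto simp: y)
    with xy show ?thesis
      by simp
  qed (use xy in simp)
qed

lemma orthant_strictly_monotonic_iff_orthogonal:
  fixes N :: "real^'d \<Rightarrow> real"
  assumes "is_norm N"
  shows "orthant_strictly_monotonic N \<longleftrightarrow> complementary_orthogonal N"
proof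
  assume mono: "orthant_strictly_monotonic N"
  have "N u < N (u + v)"
    if uv: "u \<in> coord_subspace K" "v \<in> coord_subspace (- K)" "v \<noteq> 0" for K u v
  proof -
    \<comment> \<open>no entry is nonzero in both \<open>u\<close> and \<open>v\<close>\<close>
    have disj: "u $ i = 0 \<or> v $ i = 0" for i
      using uv(1,2) by (auto simp: coord_subspace_def)
    obtain j where "v $ j \<noteq> 0"
      using uv(3) by (auto simp: vec_eq_iff)
    then have "\<bar>u $ j\<bar> < \<bar>(u + v) $ j\<bar>"
      using disj[of j] by simp
    moreover have "\<bar>u $ i\<bar> \<le> \<bar>(u + v) $ i\<bar>" for i
      using disj[of i] by auto
    ultimately have "\<bar>u\<bar> < \<bar>u + v\<bar>"
      unfolding abs_vec_less_iff by blast
    moreover have "0 \<le> u * (u + v)"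
      unfolding less_eq_vec_def
    proof
      fix i show "0 $ i \<le> (u * (u + v)) $ i"
        using disj[of i] by auto
    qed
    ultimately show ?thesis
      using mono unfolding orthant_strictly_monotonic_def by blast
  qed
  then show "complementary_orthogonal N"
    unfolding strictly_Birkhoff_orthogonal_def by blast
next
  assume orth: "complementary_orthogonal N"
  show "orthant_strictly_monotonic N"
    unfolding orthant_strictly_monotonic_def
  proof (intro allI impI)
    fix x x' :: "real^'d" assume "\<bar>x\<bar> < \<bar>x'\<bar> \<and> 0 \<le> x * x'"
    then show "N x < N x'"
      by (intro norm_grow_entries_less[OF assms orth])
        (auto simp: abs_vec_less_iff less_eq_vec_def)
  qed
qed

section \<open>Restrictions of vectors to sets of coordinates\<close>

lemma orthogonal_iff_restrict_less:
  fixes N :: "real^'d \<Rightarrow> real"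
  shows "complementary_orthogonal N \<longleftrightarrow>
    (\<forall>x J K. J \<subset> K \<longrightarrow> coord_restrict x J \<noteq> coord_restrict x K \<longrightarrow>
       N (coord_restrict x J) < N (coord_restrict x K))"
    (is "_ \<longleftrightarrow> ?restrict")
proof
  assume orth: "complementary_orthogonal N"
  show ?restrict
  proof (intro allI impI)
    fix x :: "real^'d" and J K :: "'d set"
    assume "J \<subset> K" and ne: "coord_restrict x J \<noteq> coord_restrict x K"
    have "coord_restrict x J \<in> coord_subspace J"
      "coord_restrict x K - coord_restrict x J \<in> coord_subspace (- J)"
      using \<open>J \<subset> K\<close> by (auto simp: coord_restrict_def coord_subspace_def)
    from complementary_orthogonalD[OF orth this] ne
    show "N (coord_restrict x J) < N (coord_restrict x K)"
      by simp
  qed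
next
  assume restrict: ?restrict
  have "N u < N (u + v)"
    if "u \<in> coord_subspace K" "v \<in> coord_subspace (- K)" "v \<noteq> 0" for K u v
  proof -
    have "K \<subset> UNIV"
      using that(2,3) by (auto simp: coord_subspace_def vec_eq_iff)
    moreover have "coord_restrict (u + v) K = u" "coord_restrict (u + v) UNIV = u + v"
      using that(1,2) by (auto simp: coord_restrict_def coord_subspace_def vec_eq_iff)
    ultimately show ?thesis
      using restrict that(3) by (metis add_cancel_right_right)
  qed
  then show "complementary_orthogonal N"
    unfolding strictly_Birkhoff_orthogonal_def by blast
qed

lemma norm_restrict_less:
  assumes "complementary_orthogonal N" "coord_restrict x K \<noteq> x"
  shows "N (coord_restrict x K) < N x"
proof -
  have "coord_restrict x K \<in> coord_subspace K" "x - coord_restrict x K \<in> coord_subspace (- K)"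
    by (auto simp: coord_restrict_def coord_subspace_def)
  from complementary_orthogonalD[OF assms(1) this] assms(2) show ?thesis
    by simp
qed

lemma inner_restrict_left:
  "coord_restrict x K \<bullet> y = x \<bullet> coord_restrict y K"
  unfolding inner_vec_def coord_restrict_def by (intro sum.cong) auto

section \<open>Dual vectors with the same support and signs\<close>

text \<open>Deleting the entry \<open>u\<^sub>j\<close> decreases the norm, while the linear functional \<open>v\<close>, which agrees
  with the norm at \<open>u\<close> and nowhere exceeds it, drops by exactly \<open>u\<^sub>j v\<^sub>j\<close>.\<close>

lemma subgradient_entry_pos:
  fixes N :: "real^'d \<Rightarrow> real"
  assumes orth: "complementary_orthogonal N"
    and "u \<bullet> v = N u" "\<And>x. x \<bullet> v \<le> N x" "u $ j \<noteq> 0"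
  shows "0 < u $ j * v $ j"
proof -
  let ?u = "coord_restrict u (- {j})"
  have "?u $ j \<noteq> u $ j"
    using assms(4) by (simp add: coord_restrict_def)
  then have "N ?u < N u"
    by (intro norm_restrict_less[OF orth]) auto
  moreover have "?u = u - axis j (u $ j)"
    by (auto simp: coord_restrict_def axis_def vec_eq_iff)
  then have "?u \<bullet> v = N u - u $ j * v $ j"
    using assms(2) by (simp add: inner_diff_left inner_axis')
  ultimately show ?thesis
    using assms(3)[of ?u] by linarith
qed

lemma orthogonal_imp_ex_dual_vector:
  fixes N :: "real^'d \<Rightarrow> real"
  assumes nN: "is_norm N" and orth: "complementary_orthogonal N" and u: "u \<noteq> 0"
  shows "\<exists>v. v \<noteq> 0 \<and> supp v = supp u \<and> u * v \<ge> 0 \<and> u \<bullet> v = N u * dual_norm N v"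
proof -
  obtain w where w: "u \<bullet> w = N u" "\<And>x. x \<bullet> w \<le> N x"
    using ex_subgradient[OF nN u] by blast
  define v where "v = coord_restrict w (supp u)"
  have "coord_restrict u (supp u) = u"
    by (auto simp: coord_restrict_def supp_def vec_eq_iff)
  then have uv: "u \<bullet> v = N u"
    using w(1) by (simp add: v_def flip: inner_restrict_left)
  have "x \<bullet> v \<le> N (coord_restrict x (supp u))" for x
    using w(2) by (simp add: v_def flip: inner_restrict_left)
  moreover have "N (coord_restrict x (supp u)) \<le> N x" for x
    using norm_restrict_less[OF orth, of x "supp u"] by fastforce
  ultimately have sub: "x \<bullet> v \<le> N x" for x
    using order_trans by blast
  have sign: "0 < u $ j * v $ j" if "u $ j \<noteq> 0" for j
    using orth uv sub that by (rule subgradient_entry_pos)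
  have "v \<noteq> 0"
    using uv is_norm_pos[OF nN u] by auto
  moreover have "supp v = supp u"
    using sign by (fastforce simp: supp_def v_def coord_restrict_def)
  moreover have "0 \<le> u * v"
    unfolding less_eq_vec_def using sign by (metis less_imp_le mult_zero_left order_refl
      vector_mult_component zero_index)
  moreover have "u \<bullet> v = N u * dual_norm N v"
    using dual_norm_eq_1[OF nN u uv sub] uv by simp
  ultimately show ?thesis
    by blast
qed

text \<open>The weak inequality is needed at the midpoint \<open>m\<close> of \<open>u\<close> and \<open>u + w\<close>. A dual vector of
  \<open>u + w\<close> itself would only bound \<open>N u\<close> from below by something less than \<open>N (u + w)\<close>; one of
  \<open>m\<close> has the signs of \<open>w\<close> on the support of \<open>w\<close> and so still increases from \<open>m\<close> to
  \<open>u + w\<close>.\<close>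

lemma ex_dual_vector_imp_orthogonal:
  fixes N :: "real^'d \<Rightarrow> real"
  assumes nN: "is_norm N"
    and dual: "\<And>u. u \<noteq> 0 \<Longrightarrow>
      \<exists>v. v \<noteq> 0 \<and> supp v = supp u \<and> u * v \<ge> 0 \<and> u \<bullet> v = N u * dual_norm N v"
  shows "complementary_orthogonal N"
proof -
  have weak: "N u \<le> N (u + w)"
    if uw: "u \<in> coord_subspace K" "w \<in> coord_subspace (- K)" for K u w
  proof (cases "u = 0")
    case True
    moreover have "N 0 = 0" "0 \<le> N w"
      using nN by (auto simp: is_norm_def)
    ultimately show ?thesis
      by simp
  next
    case False
    then obtain v where v: "v \<noteq> 0" "supp v = supp u" "u \<bullet> v = N u * dual_norm N v"
      using dual by blast
    have "w $ i \<bullet> v $ i = 0" for i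
      using v(2) uw by (auto simp: supp_def coord_subspace_def)
    then have "w \<bullet> v = 0"
      unfolding inner_vec_def by (simp only: sum.neutral_const)
    then have "N u * dual_norm N v \<le> N (u + w) * dual_norm N v"
      using inner_le_dual_norm[OF nN, of "u + w" v] v(3) by (simp add: inner_add_left)
    then show ?thesis
      using dual_norm_pos[OF nN v(1)] by simp
  qed
  have "N u < N (u + w)"
    if uw: "u \<in> coord_subspace K" "w \<in> coord_subspace (- K)" "w \<noteq> 0" for K u w
  proof -
    define m where "m = u + (1/2) *\<^sub>R w"
    have m: "m $ i = w $ i / 2" if "w $ i \<noteq> 0" for i
      using uw(1,2) that by (auto simp: m_def coord_subspace_def)
    obtain j where j: "w $ j \<noteq> 0"
      using uw(3) by (auto simp: vec_eq_iff)
    then have "m \<noteq> 0"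
      using m[OF j] by auto
    then obtain v where v: "v \<noteq> 0" "supp v = supp m" "m * v \<ge> 0" "m \<bullet> v = N m * dual_norm N v"
      using dual by blast
    \<comment> \<open>where \<open>w\<close> is nonzero, \<open>v\<close> is nonzero and has the sign of \<open>m\<close>, hence that of \<open>w\<close>\<close>
    have sign: "0 < w $ i * v $ i" if "w $ i \<noteq> 0" for i
    proof -
      have "i \<in> supp v"
        unfolding v(2) using m[OF that] that by (simp add: supp_def)
      then have "v $ i \<noteq> 0"
        by (simp add: supp_def)
      moreover have "0 \<le> m $ i * v $ i"
        using v(3) by (simp add: less_eq_vec_def)
      ultimately show ?thesis
        using m[OF that] that by (auto simp: zero_le_mult_iff zero_less_mult_iff)
    qed
    have "0 < (\<Sum>i\<in>UNIV. w $ i * v $ i)"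
    proof (rule sum_pos2[of _ j])
      show "0 \<le> w $ i * v $ i" for i
        using sign[of i] by (cases "w $ i = 0") auto
    qed (use sign[OF j] in auto)
    then have "0 < w \<bullet> v"
      by (simp add: inner_vec_def)
    moreover have "u + w = m + (1/2) *\<^sub>R w"
      by (simp add: m_def vec_eq_iff)
    ultimately have "m \<bullet> v < (u + w) \<bullet> v"
      by (simp add: inner_add_left)
    then have "N m * dual_norm N v < N (u + w) * dual_norm N v"
      using inner_le_dual_norm[OF nN, of "u + w" v] v(4) by simp
    then have "N m < N (u + w)"
      using dual_norm_pos[OF nN v(1)] by simp
    moreover have "N u \<le> N m"
      unfolding m_def using uw(1,2) by (intro weak) (auto simp: coord_subspace_def)
    ultimately show ?thesis
      by simp
  qed
  then show ?thesis
    unfolding strictly_Birkhoff_orthogonal_def by blast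
qed

section \<open>Equivalence of the four assertions\<close>

theorem proposition6:
  fixes N :: "real^'d \<Rightarrow> real"
  assumes "is_norm N"
  shows "(orthant_strictly_monotonic N \<longleftrightarrow>
            (\<forall>K. strictly_Birkhoff_orthogonal N (coord_subspace K) (coord_subspace (- K)))) \<and>
         (orthant_strictly_monotonic N \<longleftrightarrow>
            (\<forall>x J K. J \<subset> K \<longrightarrow> coord_restrict x J \<noteq> coord_restrict x K \<longrightarrow>
               N (coord_restrict x J) < N (coord_restrict x K))) \<and>
         (orthant_strictly_monotonic N \<longleftrightarrow>
            (\<forall>u. u \<noteq> 0 \<longrightarrow>
               (\<exists>v. v \<noteq> 0 \<and> supp v = supp u \<and> u * v \<ge> 0 \<and> u \<bullet> v = N u * dual_norm N v)))"
proof (intro conjI)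
  note mono = orthant_strictly_monotonic_iff_orthogonal[OF assms]
  show "orthant_strictly_monotonic N \<longleftrightarrow> complementary_orthogonal N"
    by (rule mono)
  show "orthant_strictly_monotonic N \<longleftrightarrow>
      (\<forall>x J K. J \<subset> K \<longrightarrow> coord_restrict x J \<noteq> coord_restrict x K \<longrightarrow>
         N (coord_restrict x J) < N (coord_restrict x K))"
    unfolding mono by (rule orthogonal_iff_restrict_less)
  show "orthant_strictly_monotonic N \<longleftrightarrow>
      (\<forall>u. u \<noteq> 0 \<longrightarrow>
         (\<exists>v. v \<noteq> 0 \<and> supp v = supp u \<and> u * v \<ge> 0 \<and> u \<bullet> v = N u * dual_norm N v))"
    unfolding mono
    using orthogonal_imp_ex_dual_vector[OF assms] ex_dual_vector_imp_orthogonal[OF assms]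
    by blast
qed

end
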